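(* Let $\mathbb G=(V,E)$ and $\mathbb G'=(V',E')$ be simple graphs such that $V'\subset V$, $E'\subset E$ and $\mathbb G$ is $k$-friendly with respect to $\mathbb G'$, where $k\in[0,+\infty)$. Then, for any function $u:V\to\mathbb R$ and constants $q\ge p\ge1$, $$\left(\sum_{xy\in E'}|u(x)-u(y)|^q\right)^{1/q}\le\frac{2^{1-\frac pq}}{(k+2)^{\frac1p-\frac1q}}\left(\sum_{xy\in E}|u(x)-u(y)|^p\right)^{1/p}.$$
   Context: A simple graph is a pair $(V,E)$ with $V$ a finite set and $E$ a set of unordered pairs $xy:=\{x,y\}$ of distinct vertices (sums over $E$ count each unordered edge once). $N_{\mathbb G}(x)$ is the set of vertices adjacent to $x$ in $\mathbb G$ (so $x\notin N_{\mathbb G}(x)$). For simple graphs $\mathbb G=(V,E)$, $\mathbb G'=(V',E')$ with $V'\subset V$, $\mathbb G$ is $k$-friendly with respect to $\mathbb G'$ if for any two vertices $x,y\in V'$ that are adjacent in $\mathbb G'$ one has $|N_{\mathbb G}(x)\cap N_{\mathbb G}(y)|\ge k$. *)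

theory Defs
  imports "HOL-Analysis.Analysis"
begin

definition simple_graph :: "'a set \<Rightarrow> 'a set set \<Rightarrow> bool" where
  "simple_graph V E \<longleftrightarrow>
     finite V \<and> (\<forall>e\<in>E. \<exists>x y. x \<in> V \<and> y \<in> V \<and> x \<noteq> y \<and> e = {x, y})"

definition neighbours :: "'a set \<Rightarrow> 'a set set \<Rightarrow> 'a \<Rightarrow> 'a set" where
  "neighbours V E x = {y \<in> V. {x, y} \<in> E}"

definition friendly :: "real \<Rightarrow> 'a set \<Rightarrow> 'a set set \<Rightarrow> 'a set \<Rightarrow> 'a set set \<Rightarrow> bool" where
  "friendly k V E V' E' \<longleftrightarrow>
     (\<forall>x\<in>V'. \<forall>y\<in>V'. {x, y} \<in> E' \<longrightarrow>
        real (card (neighbours V E x \<inter> neighbours V E y)) \<ge> k)"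

(* An edge carries no orientation, but |u x - u y| is symmetric in x and y, so it is a
   well-defined function of the unordered pair; edge_diff_pair confirms this. *)
definition edge_diff :: "('a \<Rightarrow> real) \<Rightarrow> 'a set \<Rightarrow> real" where
  "edge_diff u e = (THE r. \<exists>x y. e = {x, y} \<and> r = \<bar>u x - u y\<bar>)"

lemma edge_diff_pair: "edge_diff u {x, y} = \<bar>u x - u y\<bar>"
  unfolding edge_diff_def
  by (rule the_equality) (auto simp: doubleton_eq_iff)

end

theory Submission
  imports Defs
begin

text \<open>
  Write \<open>S\<close> for the sum of \<open>\<bar>u x - u y\<bar>\<^sup>p\<close> over the edges of the big graph. The proof interpolates
  between the exponents \<open>p\<close> and \<open>\<infinity>\<close>: the sum of the \<open>q\<close>-th powers is at most the sum of the
  \<open>p\<close>-th powers times the \<open>(q - p)\<close>-th power of the largest difference across an edge of the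
  small graph, so all that friendliness has to provide is the pointwise bound
  \<open>(k + 2) \<bar>u x - u y\<bar>\<^sup>p \<le> 2\<^sup>p S\<close> for every edge \<open>xy\<close> of the small graph
  (lemma \<open>friendly_edge_diff_le\<close>).

  For the pointwise bound, put \<open>d = \<bar>u x - u y\<bar>\<close>. If \<open>z\<close> is a common neighbour of \<open>x\<close> and \<open>y\<close>,
  then by the triangle inequality \<open>u\<close> varies by at least \<open>d / 2\<close> across one of the edges
  \<open>xz\<close>, \<open>yz\<close>. The edges so chosen for different \<open>z\<close> are different from each other
  and from \<open>xy\<close>, whence \<open>S \<ge> d\<^sup>p + k (d / 2)\<^sup>p\<close>. As \<open>p \<ge> 1\<close>, the first summand is
  at least \<open>2 (d / 2)\<^sup>p\<close>, which gives \<open>S \<ge> (k + 2) (d / 2)\<^sup>p\<close>.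
\<close>

lemma simple_graph_finite_edges:
  assumes "simple_graph V E"
  shows "finite E"
proof (rule finite_subset)
  show "E \<subseteq> Pow V" using assms by (fastforce simp: simple_graph_def)
  show "finite (Pow V)" using assms by (simp add: simple_graph_def)
qed

lemma simple_graph_no_loop:
  assumes "simple_graph V E" and "{x, y} \<in> E"
  shows "x \<noteq> y"
  using assms by (fastforce simp: simple_graph_def doubleton_eq_iff)

lemma simple_graph_edge_vertices:
  assumes "simple_graph V E" and "{x, y} \<in> E"
  shows "x \<in> V" "y \<in> V"
  using assms by (fastforce simp: simple_graph_def doubleton_eq_iff)+

lemma simple_graph_edgeE:
  assumes "simple_graph V E" and "e \<in> E"
  obtains x y where "e = {x, y}"
  using assms by (auto simp: simple_graph_def)

text \<open>
  Among the two edges that join a common neighbour to \<open>x\<close> and \<open>y\<close>, keep the one across which \<open>u\<close>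
  varies more. The resulting family of edges is indexed injectively by the common neighbours,
  because a common neighbour is neither \<open>x\<close> nor \<open>y\<close>.
\<close>

lemma sum_edge_diff_ge_common_neighbours:
  fixes u :: "'a \<Rightarrow> real"
  assumes G: "simple_graph V E" and xy: "{x, y} \<in> E" and p: "p \<ge> 0"
  defines "d \<equiv> edge_diff u {x, y}"
  shows "d powr p + real (card (neighbours V E x \<inter> neighbours V E y)) * (d / 2) powr p
           \<le> (\<Sum>e\<in>E. edge_diff u e powr p)"
proof -
  define N where "N = neighbours V E x \<inter> neighbours V E y"
  define f where
    "f z = (if \<bar>u x - u z\<bar> \<ge> \<bar>u y - u z\<bar> then {x, z} else {y, z})" for z
  have finN: "finite N"
    using G by (auto simp: N_def neighbours_def simple_graph_def)
  have edges: "{x, z} \<in> E" "{y, z} \<in> E" if "z \<in> N" for z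
    using that by (auto simp: N_def neighbours_def)
  have ne: "z \<noteq> x" "z \<noteq> y" if "z \<in> N" for z
    using simple_graph_no_loop[OF G] edges[OF that] by blast+
  have inj: "inj_on f N"
    using ne by (auto simp: inj_on_def f_def doubleton_eq_iff split: if_splits)
  have sub: "insert {x, y} (f ` N) \<subseteq> E"
    using edges xy by (auto simp: f_def)
  have notin: "{x, y} \<notin> f ` N"
    using ne by (auto simp: f_def doubleton_eq_iff split: if_splits)
  have half: "d / 2 \<le> edge_diff u (f z)" for z
  proof -
    have "\<bar>u x - u y\<bar> \<le> \<bar>u x - u z\<bar> + \<bar>u y - u z\<bar>" by linarith
    then show ?thesis
      unfolding f_def d_def by (cases "\<bar>u x - u z\<bar> \<ge> \<bar>u y - u z\<bar>") (simp_all add: edge_diff_pair)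
  qed
  have "real (card N) * (d / 2) powr p = (\<Sum>z\<in>N. (d / 2) powr p)"
    by simp
  also have "\<dots> \<le> (\<Sum>z\<in>N. edge_diff u (f z) powr p)"
    by (intro sum_mono powr_mono2 half) (use p in \<open>auto simp: d_def edge_diff_pair\<close>)
  also have "\<dots> = (\<Sum>e\<in>f ` N. edge_diff u e powr p)"
    by (simp add: sum.reindex[OF inj])
  finally have "d powr p + real (card N) * (d / 2) powr p
      \<le> (\<Sum>e\<in>insert {x, y} (f ` N). edge_diff u e powr p)"
    using finN notin by (simp add: d_def)
  also have "\<dots> \<le> (\<Sum>e\<in>E. edge_diff u e powr p)"
    by (intro sum_mono2 sub simple_graph_finite_edges[OF G]) auto
  finally show ?thesis by (simp add: N_def)
qed

text \<open>
  This is the case \<open>q = \<infinity>\<close> of the theorem, raised to the power \<open>p\<close>. The constant \<open>2\<close> in \<open>k + 2\<close>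
  is the contribution of the edge \<open>e\<close> itself, through \<open>2 \<le> 2\<^sup>p\<close>.
\<close>

lemma friendly_edge_diff_le:
  fixes u :: "'a \<Rightarrow> real"
  assumes G: "simple_graph V E" and G': "simple_graph V' E'" and sub: "E' \<subseteq> E"
    and k: "k \<ge> 0" and fr: "friendly k V E V' E'" and p: "p \<ge> 1" and e: "e \<in> E'"
  shows "edge_diff u e powr p \<le> 2 powr p * (\<Sum>e\<in>E. edge_diff u e powr p) / (k + 2)"
proof -
  obtain x y where exy: "e = {x, y}"
    using simple_graph_edgeE[OF G' e] .
  define d where "d = edge_diff u e"
  define c where "c = real (card (neighbours V E x \<inter> neighbours V E y))"
  have d0: "d \<ge> 0" by (simp add: d_def exy edge_diff_pair)
  have "x \<in> V'" "y \<in> V'"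
    using simple_graph_edge_vertices[OF G'] e exy by auto
  then have kc: "k \<le> c"
    using fr e exy by (auto simp: friendly_def c_def)
  have "(2::real) powr 1 \<le> 2 powr p" using p by (intro powr_mono) auto
  then have "(k + 2) * d powr p \<le> (c + 2 powr p) * d powr p"
    using kc by (intro mult_right_mono) auto
  also have "\<dots> = 2 powr p * (d powr p + c * (d / 2) powr p)"
    using d0 by (simp add: powr_divide field_simps)
  also have "\<dots> \<le> 2 powr p * (\<Sum>e\<in>E. edge_diff u e powr p)"
    using sum_edge_diff_ge_common_neighbours[OF G, of x y p u] sub e exy p
    by (intro mult_left_mono) (auto simp: d_def c_def)
  finally show ?thesis using k by (simp add: d_def field_simps)
qed

text \<open>
  Interpolation between \<open>p\<close> and \<open>\<infinity>\<close>: each \<open>q\<close>-th power splits as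
  \<open>a\<^sup>q = a\<^sup>p (a\<^sup>p)\<^bsup>q/p - 1\<^esup>\<close>, and the second factor is bounded uniformly.
\<close>

lemma sum_powr_le_bound_mult_sum_powr:
  fixes f :: "'b \<Rightarrow> real"
  assumes p: "0 < p" and pq: "p \<le> q"
    and bound: "\<And>i. i \<in> A \<Longrightarrow> f i powr p \<le> C"
  shows "(\<Sum>i\<in>A. f i powr q) \<le> C powr (q / p - 1) * (\<Sum>i\<in>A. f i powr p)"
proof -
  have "f i powr q \<le> C powr (q / p - 1) * f i powr p" if i: "i \<in> A" for i
  proof -
    have "p + p * (q / p - 1) = q" using p by (simp add: field_simps)
    then have "f i powr q = f i powr p * (f i powr p) powr (q / p - 1)"
      by (metis powr_add powr_powr)
    also have "\<dots> \<le> f i powr p * C powr (q / p - 1)"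
      using p pq bound[OF i] by (intro mult_left_mono powr_mono2) auto
    finally show ?thesis by (simp add: mult.commute)
  qed
  then show ?thesis by (simp add: sum_distrib_left sum_mono)
qed

theorem lemma3p3:
  fixes V V' :: "'a set" and E E' :: "'a set set"
    and k p q :: real and u :: "'a \<Rightarrow> real"
  assumes "simple_graph V E" and "simple_graph V' E'"
    and "V' \<subseteq> V" and "E' \<subseteq> E"
    and "k \<ge> 0"
    and "friendly k V E V' E'"
    and "q \<ge> p" and "p \<ge> 1"
  shows "(\<Sum>e\<in>E'. edge_diff u e powr q) powr (1 / q)
       \<le> 2 powr (1 - p / q) / (k + 2) powr (1 / p - 1 / q)
           * (\<Sum>e\<in>E. edge_diff u e powr p) powr (1 / p)"
proof -
  define S where "S = (\<Sum>e\<in>E. edge_diff u e powr p)"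
  define C where "C = 2 powr p * S / (k + 2)"
  have p: "0 < p" and q: "0 < q" using assms by auto
  have S0: "0 \<le> S" by (simp add: S_def sum_nonneg)
  have C0: "0 \<le> C" using S0 assms by (simp add: C_def)
  have "(\<Sum>e\<in>E'. edge_diff u e powr q)
      \<le> C powr (q / p - 1) * (\<Sum>e\<in>E'. edge_diff u e powr p)"
  proof (rule sum_powr_le_bound_mult_sum_powr[OF p])
    show "p \<le> q" by fact
    show "edge_diff u e powr p \<le> C" if "e \<in> E'" for e
      using friendly_edge_diff_le assms that unfolding C_def S_def by metis
  qed
  also have "\<dots> \<le> C powr (q / p - 1) * S"
    unfolding S_def using assms
    by (intro mult_left_mono sum_mono2) (auto intro: simple_graph_finite_edges)
  finally have "(\<Sum>e\<in>E'. edge_diff u e powr q) powr (1 / q)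
      \<le> (C powr (q / p - 1) * S) powr (1 / q)"
    using q by (intro powr_mono2) (auto intro: sum_nonneg)
  also have "\<dots> = C powr (1 / p - 1 / q) * S powr (1 / q)"
  proof -
    have "(q / p - 1) * (1 / q) = 1 / p - 1 / q" using p q by (simp add: field_simps)
    then show ?thesis using S0 by (simp add: powr_mult powr_powr)
  qed
  also have "\<dots> = 2 powr (1 - p / q) / (k + 2) powr (1 / p - 1 / q)
      * (S powr (1 / p - 1 / q) * S powr (1 / q))"
  proof -
    have "p * (1 / p - 1 / q) = 1 - p / q" using p q by (simp add: field_simps)
    then show ?thesis
      using S0 assms by (simp add: C_def powr_mult powr_divide powr_powr)
  qed
  also have "S powr (1 / p - 1 / q) * S powr (1 / q) = S powr (1 / p)"
    by (simp flip: powr_add)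
  finally show ?thesis by (simp add: S_def)
qed

end
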